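(* Let $M$ be a bounded domain in Euclidean space $\mathbb{R}^n$ (compact, with smooth boundary, and carrying the flat metric). For $p\in\{0,\dots,n\}$ let $\Lambda_{1,p}<\Lambda_{2,p}<\cdots$ denote the distinct eigenvalues (listed without multiplicities) of the buckling problem on $p$-forms on $M$, and let $\Gamma_{1,p}<\Gamma_{2,p}<\cdots$ denote the distinct eigenvalues (listed without multiplicities) of the clamped plate problem on $p$-forms on $M$. Then for all $i\ge1$ and all $p\in\{1,\dots,n\}$, $$\Lambda_{i,p}=\Lambda_{i,0}\qquad\text{and}\qquad\Gamma_{i,p}=\Gamma_{i,0},$$ that is, the spectra without multiplicities of the buckling and clamped plate problems on $p$-forms coincide with those of the corresponding problems on functions. Moreover, the multiplicities of $\Lambda_{i,p}$ and $\Gamma_{i,p}$ are exactly $\binom{n}{p}$ times those of $\Lambda_{i,0}$ and $\Gamma_{i,0}$, respectively.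
   Context: Let $\nu$ be the inward unit normal to $\partial M$, $\Delta=d\delta+\delta d$ the (nonnegative) Hodge Laplacian on forms and $\nabla$ the Levi-Civita connection. The buckling problem on $p$-forms is $\Delta^2\omega=\Lambda\Delta\omega$ on $M$, $\omega|_{\partial M}=0$, $\nabla_\nu\omega|_{\partial M}=0$; the clamped plate problem on $p$-forms is $\Delta^2\omega=\Gamma\omega$ on $M$, $\omega|_{\partial M}=0$, $\nabla_\nu\omega|_{\partial M}=0$. Here $\omega$ is a smooth $p$-form and $\omega|_{\partial M}=0$ means that $\omega$ vanishes pointwise on $\partial M$ (tangential and normal parts). An eigenvalue is a real number for which a nonzero solution exists, and its multiplicity is the dimension of the space of solutions; both spectra are discrete, consisting of positive eigenvalues of finite multiplicity. For $p=0$ these are the usual problems on functions $f$ with boundary conditions $f=0$ and $\partial f/\partial\nu=0$. *)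

theory Defs
  imports "HOL-Analysis.Analysis" "HOL-Library.Function_Algebras" "HOL-Library.Extended_Nat"
begin

section \<open>Smooth functions and smooth bounded domains\<close>

primrec Ck_on :: "nat \<Rightarrow> 'a::real_normed_vector set \<Rightarrow> ('a \<Rightarrow> real) \<Rightarrow> bool" where
  "Ck_on 0 U f \<longleftrightarrow> continuous_on U f"
| "Ck_on (Suc k) U f \<longleftrightarrow>
     (\<forall>x\<in>U. f differentiable (at x)) \<and> (\<forall>v. Ck_on k U (\<lambda>x. frechet_derivative f (at x) v))"

text \<open>Only meant for open sets \<open>U\<close>.\<close>

definition smooth_on :: "'a::real_normed_vector set \<Rightarrow> ('a \<Rightarrow> real) \<Rightarrow> bool" where
  "smooth_on U f \<longleftrightarrow> (\<forall>k. Ck_on k U f)"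

text \<open>Smoothness up to the boundary, for a closed set \<open>M\<close>: \<open>f\<close> extends smoothly to a neighbourhood.\<close>

definition smooth_upto :: "'a::real_normed_vector set \<Rightarrow> ('a \<Rightarrow> real) \<Rightarrow> bool" where
  "smooth_upto M f \<longleftrightarrow>
     (\<exists>U g. open U \<and> M \<subseteq> U \<and> smooth_on U g \<and> (\<forall>x\<in>M. g x = f x))"

text \<open>Since the gradient of \<open>\<rho>\<close> does not vanish, \<open>M \<inter> U = {\<rho> \<ge> 0}\<close> forces
  \<open>frontier M \<inter> U = {\<rho> = 0}\<close>, a smooth hypersurface having \<open>M\<close> on one side only.\<close>

definition defining_function ::
    "'a::euclidean_space set \<Rightarrow> 'a \<Rightarrow> 'a set \<Rightarrow> ('a \<Rightarrow> real) \<Rightarrow> bool" where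
  "defining_function M x U \<rho> \<longleftrightarrow>
     open U \<and> x \<in> U \<and> smooth_on U \<rho> \<and>
     (\<forall>y\<in>U. \<not> GDERIV \<rho> y :> 0) \<and>
     (\<forall>y\<in>U. y \<in> M \<longleftrightarrow> 0 \<le> \<rho> y)"

text \<open>\<open>M\<close> is the closed domain; the open domain is \<open>interior M\<close> and \<open>\<partial>M = frontier M\<close>.\<close>

definition smooth_bounded_domain :: "'a::euclidean_space set \<Rightarrow> bool" where
  "smooth_bounded_domain M \<longleftrightarrow>
     compact M \<and> interior M \<noteq> {} \<and> connected (interior M) \<and>
     (\<forall>x\<in>frontier M. \<exists>U \<rho>. defining_function M x U \<rho>)"

text \<open>Inward, because a defining function increases towards the inside of \<open>M\<close>.\<close>

definition inward_unit_normal :: "'a::euclidean_space set \<Rightarrow> 'a \<Rightarrow> 'a" where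
  "inward_unit_normal M x =
     (THE \<nu>. \<exists>U \<rho> g. defining_function M x U \<rho> \<and> (GDERIV \<rho> x :> g) \<and> \<nu> = g /\<^sub>R norm g)"

section \<open>Differential forms on a domain\<close>

text \<open>The value of a form at a point is a function of a list of tangent vectors, and vanishes on
  lists whose length is not the degree.\<close>

type_synonym 'a form = "'a \<Rightarrow> 'a list \<Rightarrow> real"

definition alternating :: "nat \<Rightarrow> ('a::real_vector list \<Rightarrow> real) \<Rightarrow> bool" where
  "alternating p \<alpha> \<longleftrightarrow>
     (\<forall>vs. length vs \<noteq> p \<longrightarrow> \<alpha> vs = 0) \<and>
     (\<forall>vs i. length vs = p \<and> i < p \<longrightarrow> linear (\<lambda>v. \<alpha> (vs[i := v]))) \<and>
     (\<forall>vs i j. length vs = p \<and> i < j \<and> j < p \<and> vs ! i = vs ! j \<longrightarrow> \<alpha> vs = 0)"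

text \<open>A form on \<open>M\<close> is extended by zero outside \<open>M\<close>, so that two forms on \<open>M\<close> agree
  iff they are equal as functions. This does not affect derivatives, which are taken within \<open>M\<close>.\<close>

definition smooth_form :: "'a::euclidean_space set \<Rightarrow> nat \<Rightarrow> 'a form \<Rightarrow> bool" where
  "smooth_form M p \<omega> \<longleftrightarrow>
     (\<forall>x. alternating p (\<omega> x)) \<and> (\<forall>x. x \<notin> M \<longrightarrow> \<omega> x = 0) \<and>
     (\<forall>vs. smooth_upto M (\<lambda>x. \<omega> x vs))"

text \<open>The flat Levi-Civita connection: \<open>nabla M \<omega> x v\<close> is the derivative of \<open>\<omega>\<close>
  at \<open>x\<close> in direction \<open>v\<close>, evaluated on parallel (constant) vector fields. At points of
  \<open>frontier M\<close> the derivative is the one within \<open>M\<close>.\<close>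

definition nabla :: "'a::euclidean_space set \<Rightarrow> 'a form \<Rightarrow> 'a \<Rightarrow> 'a \<Rightarrow> 'a list \<Rightarrow> real" where
  "nabla M \<omega> x v vs =
     (if x \<in> M then frechet_derivative (\<lambda>y. \<omega> y vs) (at x within M) v else 0)"

text \<open>\<open>(d\<omega>)(v\<^sub>0,\<dots>,v\<^sub>p) = \<Sum>\<^sub>i (-1)\<^sup>i (\<nabla>\<^bsub>v\<^sub>i\<^esub>\<omega>)(v\<^sub>0,\<dots>,v\<^sub>p)\<close>
  with \<open>v\<^sub>i\<close> omitted on the right.\<close>

definition ext_deriv :: "'a::euclidean_space set \<Rightarrow> 'a form \<Rightarrow> 'a form" where
  "ext_deriv M \<omega> x vs =
     (\<Sum>i<length vs. (-1) ^ i * nabla M \<omega> x (vs ! i) (take i vs @ drop (Suc i) vs))"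

text \<open>\<open>\<delta>\<omega> = - \<Sum>\<^sub>e \<iota>\<^sub>e \<nabla>\<^sub>e \<omega>\<close>, the sum running over an orthonormal basis; this is the
  formal adjoint of \<open>d\<close>, and vanishes on 0-forms.\<close>

definition codiff :: "'a::euclidean_space set \<Rightarrow> 'a form \<Rightarrow> 'a form" where
  "codiff M \<omega> x vs = - (\<Sum>e\<in>Basis. nabla M \<omega> x e (e # vs))"

definition hodge_laplacian :: "'a::euclidean_space set \<Rightarrow> 'a form \<Rightarrow> 'a form" where
  "hodge_laplacian M \<omega> = ext_deriv M (codiff M \<omega>) + codiff M (ext_deriv M \<omega>)"

section \<open>The vector space of forms and dimensions\<close>

definition form_scale :: "real \<Rightarrow> 'a form \<Rightarrow> 'a form" where
  "form_scale c \<omega> = (\<lambda>x vs. c * \<omega> x vs)"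

interpretation form: vector_space "form_scale :: real \<Rightarrow> 'a form \<Rightarrow> 'a form"
  by unfold_locales (auto simp: form_scale_def fun_eq_iff algebra_simps)

text \<open>\<open>form.dim\<close> is 0 on infinite-dimensional spaces, hence the case distinction.\<close>

definition form_dim :: "'a form set \<Rightarrow> enat" where
  "form_dim V = (if \<exists>B. finite B \<and> V \<subseteq> form.span B then enat (form.dim V) else \<infinity>)"

section \<open>The buckling and clamped plate problems\<close>

definition clamped_boundary :: "'a::euclidean_space set \<Rightarrow> 'a form \<Rightarrow> bool" where
  "clamped_boundary M \<omega> \<longleftrightarrow>
     (\<forall>x\<in>frontier M. \<omega> x = 0 \<and> nabla M \<omega> x (inward_unit_normal M x) = 0)"

definition buckling_solutions :: "'a::euclidean_space set \<Rightarrow> nat \<Rightarrow> real \<Rightarrow> 'a form set" where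
  "buckling_solutions M p \<Lambda> =
     {\<omega>. smooth_form M p \<omega> \<and> clamped_boundary M \<omega> \<and>
         (\<forall>x\<in>M. hodge_laplacian M (hodge_laplacian M \<omega>) x =
                form_scale \<Lambda> (hodge_laplacian M \<omega>) x)}"

definition plate_solutions :: "'a::euclidean_space set \<Rightarrow> nat \<Rightarrow> real \<Rightarrow> 'a form set" where
  "plate_solutions M p \<Gamma> =
     {\<omega>. smooth_form M p \<omega> \<and> clamped_boundary M \<omega> \<and>
         (\<forall>x\<in>M. hodge_laplacian M (hodge_laplacian M \<omega>) x = form_scale \<Gamma> \<omega> x)}"

definition buckling_spectrum :: "'a::euclidean_space set \<Rightarrow> nat \<Rightarrow> real set" where
  "buckling_spectrum M p = {\<Lambda>. \<exists>\<omega>\<in>buckling_solutions M p \<Lambda>. \<omega> \<noteq> 0}"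

definition plate_spectrum :: "'a::euclidean_space set \<Rightarrow> nat \<Rightarrow> real set" where
  "plate_spectrum M p = {\<Gamma>. \<exists>\<omega>\<in>plate_solutions M p \<Gamma>. \<omega> \<noteq> 0}"

text \<open>The \<open>i\<close>-th smallest element of \<open>S\<close>, counted from \<open>i = 1\<close>. Both spectra are discrete and
  bounded below, so this enumerates the distinct eigenvalues in increasing order.\<close>

definition ith_smallest :: "real set \<Rightarrow> nat \<Rightarrow> real" where
  "ith_smallest S i = (THE x. x \<in> S \<and> finite {y\<in>S. y \<le> x} \<and> card {y\<in>S. y \<le> x} = i)"

definition buckling_eigenvalue :: "'a::euclidean_space set \<Rightarrow> nat \<Rightarrow> nat \<Rightarrow> real" where
  "buckling_eigenvalue M i p = ith_smallest (buckling_spectrum M p) i"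

definition plate_eigenvalue :: "'a::euclidean_space set \<Rightarrow> nat \<Rightarrow> nat \<Rightarrow> real" where
  "plate_eigenvalue M i p = ith_smallest (plate_spectrum M p) i"

definition buckling_multiplicity :: "'a::euclidean_space set \<Rightarrow> nat \<Rightarrow> real \<Rightarrow> enat" where
  "buckling_multiplicity M p \<Lambda> = form_dim (buckling_solutions M p \<Lambda>)"

definition plate_multiplicity :: "'a::euclidean_space set \<Rightarrow> nat \<Rightarrow> real \<Rightarrow> enat" where
  "plate_multiplicity M p \<Gamma> = form_dim (plate_solutions M p \<Gamma>)"

end

theory Submission
  imports Defs
begin

text \<open>On a flat domain \<open>d\<delta> + \<delta>d\<close> acts on the components of a form with respect to parallel vector
  fields as the Laplacian on functions, because the mixed second derivatives cancel, and the clamped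
  boundary conditions are conditions on the components as well. Expanding in the constant forms
  \<open>dx\<^sub>I\<close>, the space of solutions in degree \<open>p\<close> is therefore a direct sum of \<open>n choose p\<close> copies of the
  space of solutions in degree 0, for every real \<open>\<Lambda>\<close> or \<open>\<Gamma>\<close>, whether it is an eigenvalue or not.\<close>

section \<open>Smooth functions\<close>

text \<open>The delicate point is the boundary. Derivatives of forms are taken within M, and at a
  point of \<open>frontier M\<close> it must first be shown that the function determines such a
  derivative. The non-vanishing gradients of the defining functions give this. Once unique, the
  derivative within M is that of any smooth extension to a neighbourhood, so symmetry of second
  derivatives carries over from open sets to all of M. The resulting identities hold at every point
  of the space, with value 0 outside M. They can therefore be substituted under further derivatives,
  and the formula for the Laplacian can be applied twice, as the fourth-order equations require.
  Dimensions are compared through maps in both directions: multiplication of a function by dx_I, and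
  extraction of the coefficient at dx_I.\<close>

lemma Ck_on_cong:
  assumes "open U" "\<And>x. x \<in> U \<Longrightarrow> f x = g x" "Ck_on k U f"
  shows "Ck_on k U g"
  using assms
proof (induction k arbitrary: f g)
  case 0
  then show ?case using continuous_on_cong[OF refl, of U f g] by simp
next
  case (Suc k)
  have f: "f differentiable at x" if "x \<in> U" for x
    using Suc.prems(3) that by auto
  have "g differentiable at x" if x: "x \<in> U" for x
  proof -
    obtain D where "(f has_derivative D) (at x)"
      using f[OF x] unfolding differentiable_def ..
    then have "(g has_derivative D) (at x)"
      by (rule has_derivative_transform_within_open[OF _ Suc.prems(1) x Suc.prems(2)])
    then show ?thesis by (rule differentiableI)
  qed
  moreover have "Ck_on k U (\<lambda>x. frechet_derivative g (at x) v)" for v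
  proof (rule Suc.IH[OF Suc.prems(1)])
    show "Ck_on k U (\<lambda>x. frechet_derivative f (at x) v)"
      using Suc.prems(3) by simp
    show "frechet_derivative f (at x) v = frechet_derivative g (at x) v" if "x \<in> U" for x
      using frechet_derivative_transform_within_open[OF f[OF that] Suc.prems(1) that Suc.prems(2)] by simp
  qed
  ultimately show ?case by simp
qed

lemma Ck_on_subset: "Ck_on k U f \<Longrightarrow> V \<subseteq> U \<Longrightarrow> Ck_on k V f"
  by (induction k arbitrary: f) (auto intro: continuous_on_subset)

lemma Ck_on_const: "Ck_on k U (\<lambda>x. c)"
  by (induction k arbitrary: c) auto

lemma frechet_derivative_add:
  assumes "f differentiable at x" "g differentiable at x"
  shows "frechet_derivative (\<lambda>x. f x + g x) (at x) v = 
    frechet_derivative f (at x) v + frechet_derivative g (at x) v"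
  using frechet_derivative_at[OF has_derivative_add[OF assms[unfolded frechet_derivative_works]]]
  by (simp add: fun_eq_iff)

lemma frechet_derivative_cmult:
  fixes f :: "'a::real_normed_vector \<Rightarrow> real"
  assumes "f differentiable at x"
  shows "frechet_derivative (\<lambda>x. c * f x) (at x) v = c * frechet_derivative f (at x) v"
  using frechet_derivative_at[OF has_derivative_mult_right[OF assms[unfolded frechet_derivative_works], of c]]
  by (simp add: fun_eq_iff)

lemma Ck_on_add: "open U \<Longrightarrow> Ck_on k U f \<Longrightarrow> Ck_on k U g \<Longrightarrow> Ck_on k U (\<lambda>x. f x + g x)"
proof (induction k arbitrary: f g)
  case 0
  then show ?case by (auto intro: continuous_on_add)
next
  case (Suc k)
  \<comment> \<open>The sum rule is available only on U, where f and g are differentiable, so the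
    two derivative functions are exchanged by \<open>Ck_on_cong\<close> and not by
    rewriting.\<close>
  have "Ck_on k U (\<lambda>x. frechet_derivative (\<lambda>x. f x + g x) (at x) v)" for v
    by (rule Ck_on_cong[OF Suc.prems(1) _ Suc.IH[OF Suc.prems(1)]])
      (use Suc.prems in \<open>auto simp: frechet_derivative_add\<close>)
  then show ?case using Suc.prems by auto
qed

lemma Ck_on_cmult: "open U \<Longrightarrow> Ck_on k U f \<Longrightarrow> Ck_on k U (\<lambda>x. c * f x)"
proof (induction k arbitrary: f)
  case 0
  then show ?case by (auto intro: continuous_intros)
next
  case (Suc k)
  have "Ck_on k U (\<lambda>x. frechet_derivative (\<lambda>x. c * f x) (at x) v)" for v
    by (rule Ck_on_cong[OF Suc.prems(1) _ Suc.IH[OF Suc.prems(1)]])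
      (use Suc.prems in \<open>auto simp: frechet_derivative_cmult\<close>)
  then show ?case using Suc.prems by auto
qed

lemma smooth_on_differentiable: "smooth_on U f \<Longrightarrow> x \<in> U \<Longrightarrow> f differentiable at x"
  unfolding smooth_on_def using Ck_on.simps(2)[of 0 U f] by blast

lemma smooth_on_continuous: "smooth_on U f \<Longrightarrow> continuous_on U f"
  unfolding smooth_on_def using Ck_on.simps(1)[of U f] by blast

lemma smooth_on_frechet_derivative:
  "smooth_on U f \<Longrightarrow> smooth_on U (\<lambda>x. frechet_derivative f (at x) v)"
  unfolding smooth_on_def
proof
  fix k assume "\<forall>k. Ck_on k U f"
  then have "Ck_on (Suc k) U f" ..
  then show "Ck_on k U (\<lambda>x. frechet_derivative f (at x) v)" by simp
qed

lemma smooth_uptoE: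
  assumes "smooth_upto M f"
  obtains U g where "open U" "smooth_on U g" "M \<subseteq> U" "\<And>x. x \<in> M \<Longrightarrow> g x = f x"
  using assms unfolding smooth_upto_def by blast

lemma smooth_uptoI:
  assumes "open U" "smooth_on U g" "M \<subseteq> U" "\<And>x. x \<in> M \<Longrightarrow> g x = f x"
  shows "smooth_upto M f"
  using assms unfolding smooth_upto_def by blast

lemma smooth_upto_const: "smooth_upto M (\<lambda>x. c)"
  unfolding smooth_upto_def smooth_on_def
  by (intro exI[of _ UNIV] exI[of _ "\<lambda>x. c"]) (simp add: Ck_on_const)

lemma smooth_upto_add:
  assumes "smooth_upto M f" "smooth_upto M g"
  shows "smooth_upto M (\<lambda>x. f x + g x)"
proof -
  obtain U f' where f: "open U" "smooth_on U f'" "M \<subseteq> U" "\<And>x. x \<in> M \<Longrightarrow> f' x = f x"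
    using smooth_uptoE[OF assms(1)] by metis
  obtain V g' where g: "open V" "smooth_on V g'" "M \<subseteq> V" "\<And>x. x \<in> M \<Longrightarrow> g' x = g x"
    using smooth_uptoE[OF assms(2)] by metis
  have "smooth_on (U \<inter> V) (\<lambda>x. f' x + g' x)"
    using f(1,2) g(1,2) Ck_on_subset[of _ U f' "U \<inter> V"] Ck_on_subset[of _ V g' "U \<inter> V"]
    unfolding smooth_on_def by (simp add: Ck_on_add open_Int)
  then show ?thesis
    by (rule smooth_uptoI[rotated]) (use f g in auto)
qed

lemma smooth_upto_cmult:
  assumes "smooth_upto M f"
  shows "smooth_upto M (\<lambda>x. c * f x)"
proof -
  obtain U f' where f: "open U" "smooth_on U f'" "M \<subseteq> U" "\<And>x. x \<in> M \<Longrightarrow> f' x = f x"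
    using smooth_uptoE[OF assms] by metis
  then have "smooth_on U (\<lambda>x. c * f' x)"
    unfolding smooth_on_def by (simp add: Ck_on_cmult)
  then show ?thesis
    by (rule smooth_uptoI[rotated]) (use f in auto)
qed

lemma smooth_upto_minus: "smooth_upto M f \<Longrightarrow> smooth_upto M (\<lambda>x. - f x)"
  using smooth_upto_cmult[of M f "-1"] by simp

lemma smooth_upto_sum:
  "(\<And>i. i \<in> I \<Longrightarrow> smooth_upto M (f i)) \<Longrightarrow> smooth_upto M (\<lambda>x. \<Sum>i\<in>I. f i x)"
  by (induction I rule: infinite_finite_induct) (auto intro: smooth_upto_const smooth_upto_add)

section \<open>Symmetry of second derivatives\<close>

text \<open>The one-variable mean value theorem along the segment from x to x + s u.
  Differentiability is asked on the segment only, since the difference function in the symmetry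
  proof is known to be differentiable only there.\<close>

lemma mean_value_line:
  fixes f :: "'a::real_normed_vector \<Rightarrow> real"
  assumes "0 < s" "\<And>t. 0 \<le> t \<Longrightarrow> t \<le> s \<Longrightarrow> f differentiable at (x + t *\<^sub>R u)"
  obtains t where "0 < t" "t < s"
    "f (x + s *\<^sub>R u) - f x = s * frechet_derivative f (at (x + t *\<^sub>R u)) u"
proof -
  have D: "((\<lambda>t. f (x + t *\<^sub>R u)) has_real_derivative frechet_derivative f (at (x + t *\<^sub>R u)) u) (at t)"
    if "0 \<le> t" "t \<le> s" for t
  proof -
    have f: "(f has_derivative frechet_derivative f (at (x + t *\<^sub>R u))) (at (x + t *\<^sub>R u))"
      using assms(2) that frechet_derivative_works by blast
    have "((\<lambda>t. x + t *\<^sub>R u) has_derivative (\<lambda>h. h *\<^sub>R u)) (at t)"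
      by (auto intro!: derivative_eq_intros)
    from has_derivative_compose[OF this f] show ?thesis
      unfolding has_field_derivative_def
      by (rule has_derivative_eq_rhs)
        (simp add: fun_eq_iff linear_cmul[OF has_derivative_linear[OF f]])
  qed
  obtain t where "0 < t" "t < s" 
      "f (x + s *\<^sub>R u) - f (x + 0 *\<^sub>R u) = (s - 0) * frechet_derivative f (at (x + t *\<^sub>R u)) u"
    using MVT2[OF assms(1) D] by metis
  then show ?thesis using that by simp
qed

lemma frechet_derivative_commute:
  fixes f :: "'a::real_normed_vector \<Rightarrow> real"
  assumes "open U" "smooth_on U f" "x \<in> U"
  shows "frechet_derivative (\<lambda>y. frechet_derivative f (at y) u) (at x) v =
    frechet_derivative (\<lambda>y. frechet_derivative f (at y) v) (at x) u" (is "?A x = ?B x")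
proof -
  \<comment> \<open>By the mean value theorem, both mixed derivatives take the value of the same second
    difference quotient at points near \<open>x\<close>.\<close>
  have mixed: "\<exists>a b. 0 < a \<and> a < t \<and> 0 < b \<and> b < t \<and>
      f (x + t *\<^sub>R u + t *\<^sub>R v) - f (x + t *\<^sub>R u) - f (x + t *\<^sub>R v) + f x =
      t * (t * frechet_derivative (\<lambda>y. frechet_derivative f (at y) u) (at (x + a *\<^sub>R u + b *\<^sub>R v)) v)"
    if t: "0 < t" and sub: "\<And>a b. 0 \<le> a \<Longrightarrow> a \<le> t \<Longrightarrow> 0 \<le> b \<Longrightarrow> b \<le> t \<Longrightarrow> x + a *\<^sub>R u + b *\<^sub>R v \<in> U"
    for t u v
  proof -
    \<comment> \<open>The second difference is the increment along u of the first difference h along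
      v. One mean value theorem in direction u and one in direction v turn it into a mixed
      derivative.\<close>
    define h where "h y = f (t *\<^sub>R v + y) - f y" for y
    have fd: "f differentiable at (x + a *\<^sub>R u + b *\<^sub>R v)" if "0 \<le> a" "a \<le> t" "0 \<le> b" "b \<le> t" for a b
      using smooth_on_differentiable[OF assms(2) sub] that by blast
    have hd: "(h has_derivative (\<lambda>w. frechet_derivative f (at (x + a *\<^sub>R u + t *\<^sub>R v)) w -
        frechet_derivative f (at (x + a *\<^sub>R u)) w)) (at (x + a *\<^sub>R u))" if "0 \<le> a" "a \<le> t" for a
    proof -
      have 1: "(f has_derivative frechet_derivative f (at (x + a *\<^sub>R u))) (at (x + a *\<^sub>R u))"
        using fd[of a 0] that t by (simp add: frechet_derivative_works)
      have 2: "(f has_derivative frechet_derivative f (at (x + a *\<^sub>R u + t *\<^sub>R v))) (at (t *\<^sub>R v + (x + a *\<^sub>R u)))"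
        using fd[of a t] that t by (simp add: frechet_derivative_works add.commute)
      have "((\<lambda>y. t *\<^sub>R v + y) has_derivative (\<lambda>w. w)) (at (x + a *\<^sub>R u))"
        by (auto intro!: derivative_eq_intros)
      from has_derivative_diff[OF has_derivative_compose[OF this 2] 1] show ?thesis
        unfolding h_def .
    qed
    have "h differentiable at (x + s *\<^sub>R u)" if "0 \<le> s" "s \<le> t" for s
      using hd[OF that] unfolding differentiable_def by blast
    from mean_value_line[OF t this] obtain a where a: "0 < a" "a < t"
      "h (x + t *\<^sub>R u) - h x = t * frechet_derivative h (at (x + a *\<^sub>R u)) u"
      by blast
    have hu: "frechet_derivative h (at (x + a *\<^sub>R u)) u =
       frechet_derivative f (at (x + a *\<^sub>R u + t *\<^sub>R v)) u - frechet_derivative f (at (x + a *\<^sub>R u)) u"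
      using frechet_derivative_at[OF hd[of a], symmetric] a by simp
    have "(\<lambda>y. frechet_derivative f (at y) u) differentiable at (x + a *\<^sub>R u + b *\<^sub>R v)"
      if "0 \<le> b" "b \<le> t" for b
      using smooth_on_differentiable[OF smooth_on_frechet_derivative[OF assms(2)] sub] that a by simp
    from mean_value_line[OF t this] obtain b where b: "0 < b" "b < t"
      "frechet_derivative f (at (x + a *\<^sub>R u + t *\<^sub>R v)) u - frechet_derivative f (at (x + a *\<^sub>R u)) u
       = t * frechet_derivative (\<lambda>y. frechet_derivative f (at y) u) (at (x + a *\<^sub>R u + b *\<^sub>R v)) v"
      by blast
    show ?thesis using a b hu by (intro exI[of _ a] exI[of _ b]) (simp add: h_def algebra_simps)
  qed
  have cont: "isCont ?A x" "isCont ?B x"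
    using smooth_on_continuous[OF smooth_on_frechet_derivative[OF smooth_on_frechet_derivative[OF assms(2)]]]
      assms continuous_on_eq_continuous_at by blast+
  have close: "\<bar>?A x - ?B x\<bar> < e" if "0 < e" for e
  proof -
    have "0 < e/2" using that by simp
    have "\<forall>\<^sub>F y in nhds x. y \<in> U" using assms by (auto intro: eventually_nhds_in_open)
    moreover have "\<forall>\<^sub>F y in nhds x. dist (?A y) (?A x) < e/2"
      using cont(1) \<open>0 < e/2\<close> unfolding continuous_at_eps_delta eventually_nhds_metric by (metis)
    moreover have "\<forall>\<^sub>F y in nhds x. dist (?B y) (?B x) < e/2"
      using cont(2) \<open>0 < e/2\<close> unfolding continuous_at_eps_delta eventually_nhds_metric by (metis)
    ultimately have "\<forall>\<^sub>F y in nhds x. y \<in> U \<and> dist (?A y) (?A x) < e/2 \<and> dist (?B y) (?B x) < e/2"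
      by eventually_elim auto
    then obtain d where d: "d > 0" 
      "\<And>y. dist y x < d \<Longrightarrow> y \<in> U \<and> dist (?A y) (?A x) < e/2 \<and> dist (?B y) (?B x) < e/2"
      unfolding eventually_nhds_metric by blast
    \<comment> \<open>This t keeps the parallelogram of all x + a u + b v with 0 \<le> a, b \<le> t
      inside the ball of radius d; the summand 1 covers u = v = 0.\<close>
    define t where "t = d / (norm u + norm v + 1)"
    have t: "0 < t" unfolding t_def using d by (simp add: add_nonneg_pos)
    have tn: "t * (norm u + norm v) < d"
    proof -
      have "t * (norm u + norm v + 1) = d" unfolding t_def
        by (smt (verit) nonzero_divide_eq_eq norm_ge_zero)
      then show ?thesis using t by (simp add: algebra_simps)
    qed
    have near: "dist (x + a *\<^sub>R u + b *\<^sub>R v) x < d" if "0 \<le> a" "a \<le> t" "0 \<le> b" "b \<le> t" for a b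
    proof -
      have "dist (x + a *\<^sub>R u + b *\<^sub>R v) x = norm (a *\<^sub>R u + b *\<^sub>R v)"
        by (simp add: dist_norm add.assoc)
      also have "\<dots> \<le> a * norm u + b * norm v"
        using norm_triangle_ineq[of "a *\<^sub>R u" "b *\<^sub>R v"] that by simp
      also have "\<dots> \<le> t * norm u + t * norm v"
        using that by (intro add_mono mult_right_mono) auto
      finally show ?thesis using tn by (simp add: algebra_simps)
    qed
    obtain a b where ab: "0 < a" "a < t" "0 < b" "b < t"
      "f (x + t *\<^sub>R u + t *\<^sub>R v) - f (x + t *\<^sub>R u) - f (x + t *\<^sub>R v) + f x = t * (t * ?A (x + a *\<^sub>R u + b *\<^sub>R v))"
      using mixed[of t u v] t near d(2) by meson
    have near': "x + a *\<^sub>R v + b *\<^sub>R u \<in> U" if "0 \<le> a" "a \<le> t" "0 \<le> b" "b \<le> t" for a b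
      using near[of b a] d(2) that by (simp add: add.assoc add.commute[of "a *\<^sub>R v"])
    obtain a' b' where ab': "0 < a'" "a' < t" "0 < b'" "b' < t"
      "f (x + t *\<^sub>R v + t *\<^sub>R u) - f (x + t *\<^sub>R v) - f (x + t *\<^sub>R u) + f x = t * (t * ?B (x + a' *\<^sub>R v + b' *\<^sub>R u))"
      using mixed[of t v u] t near' by meson
    \<comment> \<open>The second difference is symmetric in u and v, so its two evaluations agree
      and the factor t * t cancels.\<close>
    have "?A (x + a *\<^sub>R u + b *\<^sub>R v) = ?B (x + a' *\<^sub>R v + b' *\<^sub>R u)"
    proof -
      have "f (x + t *\<^sub>R u + t *\<^sub>R v) = f (x + t *\<^sub>R v + t *\<^sub>R u)" by (simp add: algebra_simps)
      then have "t * (t * ?A (x + a *\<^sub>R u + b *\<^sub>R v)) = t * (t * ?B (x + a' *\<^sub>R v + b' *\<^sub>R u))"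
        using ab(5) ab'(5) by linarith
      then show ?thesis using t by simp
    qed
    moreover have "dist (?A (x + a *\<^sub>R u + b *\<^sub>R v)) (?A x) < e/2"
      using near[of a b] ab d(2) by auto
    moreover have "dist (?B (x + a' *\<^sub>R v + b' *\<^sub>R u)) (?B x) < e/2"
      using near[of b' a'] ab' d(2) by (auto simp: add.assoc add.commute[of "a' *\<^sub>R v"])
    ultimately show ?thesis unfolding dist_real_def by argo
  qed
  show ?thesis
  proof (rule ccontr)
    assume "?A x \<noteq> ?B x"
    then show False using close[of "\<bar>?A x - ?B x\<bar>"] by simp
  qed
qed

section \<open>Partial derivatives up to the boundary\<close>

text \<open>At a boundary point a ray enters M on one side only, hence the one-sided derivative at 0
  within \<open>{0..<e}\<close>. It reads off the value of the derivative in direction v.\<close>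

lemma has_derivative_within_ray:
  fixes f :: "'a::real_normed_vector \<Rightarrow> real"
  assumes "(f has_derivative f') (at x within M)" "\<And>t. 0 < t \<Longrightarrow> t < e \<Longrightarrow> x + t *\<^sub>R v \<in> M" "x \<in> M"
  shows "((\<lambda>t. f (x + t *\<^sub>R v)) has_real_derivative f' v) (at 0 within {0..<e})"
proof -
  have "((\<lambda>t. x + t *\<^sub>R v) has_derivative (\<lambda>h. h *\<^sub>R v)) (at 0 within {0..<e})"
    by (auto intro!: derivative_eq_intros)
  moreover have "(f has_derivative f') (at (x + 0 *\<^sub>R v) within (\<lambda>t. x + t *\<^sub>R v) ` {0..<e})"
    using assms(2,3) by simp (rule has_derivative_subset[OF assms(1)], force simp: le_less)
  ultimately have "((\<lambda>t. f (x + t *\<^sub>R v)) has_derivative (\<lambda>h. f' (h *\<^sub>R v))) (at 0 within {0..<e})"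
    using has_derivative_in_compose by fast
  then show ?thesis
    unfolding has_field_derivative_def
    by (rule has_derivative_eq_rhs) (simp add: fun_eq_iff linear_cmul[OF has_derivative_linear[OF assms(1)]])
qed

text \<open>This makes the derivative within \<open>M\<close> unique also at boundary points: two candidates agree on
  an open cone of directions, hence everywhere.\<close>

lemma smooth_bounded_domain_cone:
  fixes M :: "'a::euclidean_space set"
  assumes "smooth_bounded_domain M" "x \<in> M"
  obtains W where "open W" "W \<noteq> {}" "\<And>v. v \<in> W \<Longrightarrow> \<exists>e>0. \<forall>t. 0 < t \<and> t < e \<longrightarrow> x + t *\<^sub>R v \<in> M"
proof -
  have ray: "((\<lambda>t. x + t *\<^sub>R v) \<longlongrightarrow> x) (at_right 0)" for v
    by (auto intro!: tendsto_eq_intros)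
  show ?thesis
  proof (cases "x \<in> interior M")
    case True
    have "\<exists>e>0. \<forall>t. 0 < t \<and> t < e \<longrightarrow> x + t *\<^sub>R v \<in> M" for v
    proof -
      have "\<forall>\<^sub>F t in at_right 0. x + t *\<^sub>R v \<in> interior M"
        using topological_tendstoD[OF ray _ True] by auto
      then show ?thesis
        unfolding eventually_at_right_field using interior_subset by (metis subsetD)
    qed
    then show ?thesis using that[of UNIV] by auto
  next
    case False
    then have "x \<in> frontier M"
      using assms by (simp add: frontier_def closure_subset[THEN subsetD])
    then obtain U \<rho> where "defining_function M x U \<rho>"
      using assms(1) unfolding smooth_bounded_domain_def by blast
    then have U: "open U" "x \<in> U" and sm: "smooth_on U \<rho>" and grad: "\<not> GDERIV \<rho> x :> 0"
      and MU: "\<And>y. y \<in> U \<Longrightarrow> y \<in> M \<longleftrightarrow> 0 \<le> \<rho> y"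
      unfolding defining_function_def by auto
    obtain d where d: "(\<rho> has_derivative d) (at x)"
      using smooth_on_differentiable[OF sm U(2)] unfolding differentiable_def by auto
    obtain w where "d w \<noteq> 0"
      using grad d unfolding gderiv_def by (auto simp: fun_eq_iff) (metis d ext)
    \<comment> \<open>Either w or -w increases \<rho>, so the open half-space of directions with
      positive derivative is nonempty.\<close>
    then have "d w > 0 \<or> d (- w) > 0"
      using linear_neg[OF has_derivative_linear[OF d], of w] by auto
    then have ne: "{v. d v > 0} \<noteq> {}" by auto
    have op: "open {v. d v > 0}"
      using has_derivative_bounded_linear[OF d]
      by (intro open_Collect_less continuous_intros) (auto intro: linear_continuous_on)
    \<comment> \<open>Since \<rho> is nonnegative at x and increases along v, it stays positive on a
      short piece of the ray, which therefore lies in M.\<close>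
    have "\<exists>e>0. \<forall>t. 0 < t \<and> t < e \<longrightarrow> x + t *\<^sub>R v \<in> M" if v: "d v > 0" for v
    proof -
      have "((\<lambda>t. \<rho> (x + t *\<^sub>R v)) has_real_derivative d v) (at 0)"
      proof -
        have "((\<lambda>t. x + t *\<^sub>R v) has_derivative (\<lambda>h. h *\<^sub>R v)) (at 0)"
          by (auto intro!: derivative_eq_intros)
        from has_derivative_compose[OF this, of \<rho> d] d show ?thesis
          unfolding has_field_derivative_def
          by (simp add: linear_cmul[OF has_derivative_linear[OF d]] mult_commute_abs)
      qed
      from DERIV_pos_inc_right[OF this v] obtain e where e: "e > 0"
          "\<And>t. 0 < t \<Longrightarrow> t < e \<Longrightarrow> \<rho> x < \<rho> (x + t *\<^sub>R v)" by auto
      obtain e' where e': "e' > 0" "\<And>t. 0 < t \<Longrightarrow> t < e' \<Longrightarrow> x + t *\<^sub>R v \<in> U"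
        using topological_tendstoD[OF ray U] unfolding eventually_at_right_field by (metis)
      have "\<rho> x \<ge> 0" using MU[OF U(2)] assms(2) by simp
      then show ?thesis
        using e e' MU by (intro exI[of _ "min e e'"]) (fastforce)
    qed
    then show ?thesis using that[OF op ne] by blast
  qed
qed

lemma has_derivative_within_unique:
  fixes f :: "'a::euclidean_space \<Rightarrow> real"
  assumes "smooth_bounded_domain M" "x \<in> M"
    and f: "(f has_derivative f') (at x within M)" "(f has_derivative f'') (at x within M)"
  shows "f' = f''"
proof
  fix w
  obtain W where W: "open W" "W \<noteq> {}" 
    "\<And>v. v \<in> W \<Longrightarrow> \<exists>e>0. \<forall>t. 0 < t \<and> t < e \<longrightarrow> x + t *\<^sub>R v \<in> M"
    using smooth_bounded_domain_cone[OF assms(1,2)] by metis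
  have eq: "f' v = f'' v" if v: "v \<in> W" for v
  proof -
    obtain e where e: "e > 0" "\<And>t. 0 < t \<Longrightarrow> t < e \<Longrightarrow> x + t *\<^sub>R v \<in> M"
      using W(3)[OF v] by blast
    have "at 0 within {0..<e} \<noteq> bot"
      using e(1) by (auto simp: trivial_limit_within islimpt_Ico)
    then show ?thesis
      using has_derivative_within_ray[OF f(1) e(2) assms(2)] has_derivative_within_ray[OF f(2) e(2) assms(2)]
      by (metis has_field_derivative_unique)
  qed
  \<comment> \<open>As W is open, v + c w lies in W for some small c > 0. Agreement at v and at v +
    c w gives agreement at w by linearity.\<close>
  obtain v where v: "v \<in> W" using W(2) by auto
  have "((\<lambda>t. v + t *\<^sub>R w) \<longlongrightarrow> v) (at_right 0)"
    by (auto intro!: tendsto_eq_intros)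
  from topological_tendstoD[OF this W(1) v] obtain c :: real where c: "c > 0" "v + c *\<^sub>R w \<in> W"
    unfolding eventually_at_right_field using dense by blast
  have "f' v + c * f' w = f'' v + c * f'' w"
    using eq[OF c(2)] f[THEN has_derivative_linear] by (simp add: linear_add linear_cmul)
  then show "f' w = f'' w" using eq[OF v] c(1) by simp
qed

text \<open>The value 0 outside M matches \<open>nabla\<close> and turns rules for smooth functions
  into identities at all points, which can be used under another derivative.\<close>

definition partial :: "'a::euclidean_space set \<Rightarrow> 'a \<Rightarrow> ('a \<Rightarrow> real) \<Rightarrow> 'a \<Rightarrow> real" where
  "partial M v f x = (if x \<in> M then frechet_derivative f (at x within M) v else 0)"

lemma nabla_eq_partial: "nabla M \<omega> x v vs = partial M v (\<lambda>y. \<omega> y vs) x"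
  by (simp add: nabla_def partial_def)

context
  fixes M :: "'a::euclidean_space set"
  assumes M: "smooth_bounded_domain M"
begin

lemma partial_eqI: "x \<in> M \<Longrightarrow> (f has_derivative f') (at x within M) \<Longrightarrow> partial M v f x = f' v"
  using has_derivative_within_unique[OF M] frechet_derivative_works differentiable_def
  unfolding partial_def by metis

text \<open>The derivative of the extension g at x is also one within M, and g agrees with f there;
  by uniqueness it is the derivative of f, whichever extension is taken.\<close>

lemma partial_extension:
  assumes "smooth_on U g" "M \<subseteq> U" "\<And>x. x \<in> M \<Longrightarrow> g x = f x" "x \<in> M"
  shows "(f has_derivative frechet_derivative g (at x)) (at x within M)"
    and "partial M v f x = frechet_derivative g (at x) v"
proof -
  show 1: "(f has_derivative frechet_derivative g (at x)) (at x within M)"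
    using assms smooth_on_differentiable[OF assms(1), of x] has_derivative_at_withinI has_derivative_transform
      frechet_derivative_works subsetD by metis
  show "partial M v f x = frechet_derivative g (at x) v"
    using partial_eqI[OF assms(4) 1] .
qed

lemma smooth_upto_partial_works:
  assumes "smooth_upto M f" "x \<in> M"
  shows "(f has_derivative (\<lambda>v. partial M v f x)) (at x within M)"
proof -
  obtain U g where g: "smooth_on U g" "M \<subseteq> U" "\<And>x. x \<in> M \<Longrightarrow> g x = f x"
    using smooth_uptoE[OF assms(1)] by metis
  show ?thesis using partial_extension[OF g assms(2)] by presburger
qed

lemma smooth_upto_partial:
  assumes "smooth_upto M f"
  shows "smooth_upto M (partial M v f)"
proof -
  obtain U g where g: "open U" "smooth_on U g" "M \<subseteq> U" "\<And>x. x \<in> M \<Longrightarrow> g x = f x"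
    using smooth_uptoE[OF assms] by metis
  show ?thesis
    using partial_extension(2)[OF g(2-4)]
    by (intro smooth_uptoI[OF g(1) smooth_on_frechet_derivative[OF g(2), of v] g(3)]) auto
qed

text \<open>If g extends f smoothly, then its derivative along v extends
  \<open>partial M v f\<close> smoothly. Iterated derivatives of f on M are thus those of g, to
  which symmetry on an open set applies.\<close>

lemma partial_commute:
  assumes "smooth_upto M f"
  shows "partial M u (partial M v f) x = partial M v (partial M u f) x"
proof (cases "x \<in> M")
  case True
  obtain U g where g: "open U" "smooth_on U g" "M \<subseteq> U" "\<And>x. x \<in> M \<Longrightarrow> g x = f x"
    using smooth_uptoE[OF assms] by metis
  have "partial M u (partial M v f) x = 
      frechet_derivative (\<lambda>y. frechet_derivative g (at y) v) (at x) u" for u v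
    using partial_extension(2)[OF g(2-4)]
    by (intro partial_extension(2)[OF smooth_on_frechet_derivative[OF g(2)] g(3) _ True]) auto
  then show ?thesis using frechet_derivative_commute[OF g(1,2)] True g(3) by auto
qed (simp add: partial_def)

lemma partial_cmult:
  assumes "smooth_upto M f"
  shows "partial M v (\<lambda>x. c * f x) x = c * partial M v f x"
proof (cases "x \<in> M")
  case True
  then show ?thesis
    by (rule partial_eqI) (rule has_derivative_mult_right[OF smooth_upto_partial_works[OF assms]], fact)
qed (simp add: partial_def)

lemma partial_minus: "smooth_upto M f \<Longrightarrow> partial M v (\<lambda>x. - f x) x = - partial M v f x"
  using partial_cmult[of f v "-1"] by simp

lemma partial_zero: "partial M v (\<lambda>x. 0) x = 0"
  using partial_cmult[OF smooth_upto_const, of v 0 0 x] by simp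

lemma partial_add:
  assumes "smooth_upto M f" "smooth_upto M g"
  shows "partial M v (\<lambda>x. f x + g x) x = partial M v f x + partial M v g x"
proof (cases "x \<in> M")
  case True
  then show ?thesis
    by (rule partial_eqI) (rule has_derivative_add[OF assms[THEN smooth_upto_partial_works]]; fact)
qed (simp add: partial_def)

lemma partial_diff:
  assumes "smooth_upto M f" "smooth_upto M g"
  shows "partial M v (\<lambda>x. f x - g x) x = partial M v f x - partial M v g x"
  using partial_add[OF assms(1) smooth_upto_minus[OF assms(2)]] partial_minus[OF assms(2)] by simp

lemma partial_sum:
  assumes "\<And>i. i \<in> I \<Longrightarrow> smooth_upto M (f i)"
  shows "partial M v (\<lambda>x. \<Sum>i\<in>I. f i x) x = (\<Sum>i\<in>I. partial M v (f i) x)"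
  using assms
  by (induction I rule: infinite_finite_induct) (auto simp: partial_zero partial_add smooth_upto_sum)

end

section \<open>The Hodge Laplacian of a flat domain\<close>

text \<open>The sign is that of the nonnegative Laplacian, in agreement with
  \<open>hodge_laplacian\<close> on 0-forms.\<close>

definition laplacian :: "'a::euclidean_space set \<Rightarrow> ('a \<Rightarrow> real) \<Rightarrow> 'a \<Rightarrow> real" where
  "laplacian M f x = - (\<Sum>e\<in>Basis. partial M e (partial M e f) x)"

context
  fixes M :: "'a::euclidean_space set"
  assumes M: "smooth_bounded_domain M"
begin

lemma smooth_upto_laplacian: "smooth_upto M f \<Longrightarrow> smooth_upto M (laplacian M f)"
  unfolding laplacian_def[abs_def]
  by (intro smooth_upto_minus smooth_upto_sum smooth_upto_partial[OF M])

lemma partial_cmult_fun: "smooth_upto M f \<Longrightarrow> partial M v (\<lambda>x. c * f x) = (\<lambda>x. c * partial M v f x)"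
  using partial_cmult[OF M] by blast

lemma laplacian_cmult: "smooth_upto M f \<Longrightarrow> laplacian M (\<lambda>x. c * f x) = (\<lambda>x. c * laplacian M f x)"
  by (auto simp: laplacian_def partial_cmult[OF M] smooth_upto_partial[OF M] sum_distrib_left
      partial_cmult_fun)

text \<open>On a list vs, both d\<delta> and \<delta>d produce a double sum over a removed position
  i and a basis vector e that is put in front. The two sums have opposite signs and differ in the
  order of differentiation only, so they cancel; what remains are the pure second derivatives from
  \<delta>d.\<close>

lemma hodge_laplacian_eq:
  assumes sm: "\<And>vs. smooth_upto M (\<lambda>x. \<omega> x vs)"
  shows "hodge_laplacian M \<omega> = (\<lambda>x vs. laplacian M (\<lambda>y. \<omega> y vs) x)"
proof (intro ext)
  fix x :: 'a and vs :: "'a list"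
  define om where "om i = take i vs @ drop (Suc i) vs" for i
  note sm1 = smooth_upto_partial[OF M sm]
  have "ext_deriv M (codiff M \<omega>) x vs = 
      - (\<Sum>i<length vs. \<Sum>e\<in>Basis. (-1) ^ i * partial M (vs ! i) (partial M e (\<lambda>y. \<omega> y (e # om i))) x)"
    unfolding ext_deriv_def nabla_eq_partial codiff_def
    by (simp add: om_def[symmetric] partial_minus[OF M] partial_sum[OF M] sm1 smooth_upto_sum
       sum_distrib_left sum_negf)
  \<comment> \<open>In \<open>ext_deriv\<close> on e # vs, position 0 removes e itself and yields
    the pure second derivative. Position \<open>Suc i\<close> removes \<open>vs ! i\<close> with the
    sign opposite to (-1)^i.\<close>
  moreover have "codiff M (ext_deriv M \<omega>) x vs =
      - (\<Sum>e\<in>Basis. partial M e (partial M e (\<lambda>y. \<omega> y vs)) x)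
      + (\<Sum>e\<in>Basis. \<Sum>i<length vs. (-1) ^ i * partial M e (partial M (vs ! i) (\<lambda>y. \<omega> y (e # om i))) x)"
    unfolding ext_deriv_def nabla_eq_partial codiff_def
    by (simp add: sum.lessThan_Suc_shift om_def[symmetric] partial_diff[OF M] partial_sum[OF M] 
       partial_cmult[OF M] partial_minus[OF M] sm1 smooth_upto_sum smooth_upto_cmult smooth_upto_minus
       sum_subtractf sum_negf del: sum.lessThan_Suc)
  moreover have "(\<Sum>i<length vs. \<Sum>e\<in>Basis. (-1) ^ i * partial M (vs ! i) (partial M e (\<lambda>y. \<omega> y (e # om i))) x) =
      (\<Sum>e\<in>Basis. \<Sum>i<length vs. (-1) ^ i * partial M e (partial M (vs ! i) (\<lambda>y. \<omega> y (e # om i))) x)"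
    by (subst sum.swap) (simp only: partial_commute[OF M sm, of "vs ! _"])
  ultimately show "hodge_laplacian M \<omega> x vs = laplacian M (\<lambda>y. \<omega> y vs) x"
    unfolding hodge_laplacian_def laplacian_def by simp
qed

end

section \<open>Alternating forms\<close>

text \<open>\<open>det_form es\<close> is the wedge product of the covectors dual to \<open>es\<close>.\<close>

definition det_form :: "'a::real_inner list \<Rightarrow> 'a list \<Rightarrow> real" where
  "det_form es vs =
     (if length vs = length es
      then \<Sum>\<sigma> | \<sigma> permutes {..<length es}. sign \<sigma> * (\<Prod>i<length es. (vs ! \<sigma> i) \<bullet> (es ! i))
      else 0)"

lemma linear_det_form:
  assumes len: "length vs = length es" and k: "k < length es"
  shows "linear (\<lambda>v. det_form es (vs[k := v]))"
proof -
  have "linear (\<lambda>v. sign \<sigma> * (\<Prod>i<length es. (vs[k := v] ! \<sigma> i) \<bullet> (es ! i)))"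
    if \<sigma>: "\<sigma> permutes {..<length es}" for \<sigma>
  proof -
    \<comment> \<open>Only the factor at the preimage j of k under \<sigma> contains slot k, so each
      product is linear in that slot.\<close>
    obtain j where j: "j < length es" "\<sigma> j = k"
      using permutes_image[OF \<sigma>] k by (metis imageE lessThan_iff)
    have "(vs[k := v] ! \<sigma> i) \<bullet> (es ! i) = (vs ! \<sigma> i) \<bullet> (es ! i)" if "i \<in> {..<length es} - {j}" for v i
    proof -
      have "\<sigma> i \<noteq> k" using that j(2) inj_eq[OF permutes_inj[OF \<sigma>], of i j] by auto
      then show ?thesis by simp
    qed
    then have "(\<Prod>i<length es. (vs[k := v] ! \<sigma> i) \<bullet> (es ! i)) =
        (v \<bullet> (es ! j)) * (\<Prod>i\<in>{..<length es} - {j}. (vs ! \<sigma> i) \<bullet> (es ! i))" for v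
      using j k len by (simp add: prod.remove[of "{..<length es}" j])
    then show ?thesis
      by (auto intro!: linearI simp: inner_add_left algebra_simps)
  qed
  then show ?thesis
    unfolding det_form_def using len by (auto intro!: linear_compose_sum)
qed

text \<open>Composing every permutation with the transposition of i and j leaves the products
  unchanged, because the two entries agree, and flips all signs. The sum equals its own
  negative.\<close>

lemma det_form_eq_0:
  assumes len: "length vs = length es" and ij: "i < j" "j < length es" "vs ! i = vs ! j"
  shows "det_form es vs = 0"
proof -
  define \<tau> where "\<tau> = Transposition.transpose i j"
  have \<tau>: "\<tau> permutes {..<length es}"
    unfolding \<tau>_def using ij by (intro permutes_swap_id) auto
  have nth: "vs ! \<tau> k = vs ! k" for k
    using ij unfolding \<tau>_def by (simp add: Transposition.transpose_def)
  have sgn: "sign (\<tau> \<circ> \<sigma>) = - sign \<sigma>" if "\<sigma> permutes {..<length es}" for \<sigma>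
  proof -
    have "permutation \<sigma>" "permutation \<tau>"
      using that \<tau> by (auto simp: permutation_permutes)
    then show ?thesis
      using ij by (simp add: sign_compose \<tau>_def sign_swap_id)
  qed
  have "det_form es vs = (\<Sum>\<sigma> | \<sigma> permutes {..<length es}. 
      sign (\<tau> \<circ> \<sigma>) * (\<Prod>i<length es. (vs ! (\<tau> \<circ> \<sigma>) i) \<bullet> (es ! i)))"
    unfolding det_form_def using len by (subst setum_permutations_compose_left[OF \<tau>]) simp
  also have "\<dots> = - det_form es vs"
    unfolding det_form_def using len by (simp add: sgn nth sum_negf)
  finally show ?thesis by simp
qed

lemma alternating_det_form:
  assumes "length es = p"
  shows "alternating p (det_form es)"
  unfolding alternating_def
proof (intro conjI allI impI; (elim conjE)?)
  show "det_form es vs = 0" if "length vs \<noteq> p" for vs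
    using that assms by (simp add: det_form_def)
  show "linear (\<lambda>v. det_form es (vs[i := v]))" if "length vs = p" "i < p" for vs i
    using that assms by (simp add: linear_det_form)
  show "det_form es vs = 0" if "length vs = p" "i < j" "j < p" "vs ! i = vs ! j" for vs i j
    using that assms by (intro det_form_eq_0[of _ _ i j]) auto
qed

text \<open>By orthonormality a permutation that moves some i contributes a zero factor, so only the
  identity survives.\<close>

lemma det_form_self:
  assumes "distinct es" "set es \<subseteq> Basis"
  shows "det_form es es = 1"
proof -
  have "sign \<sigma> * (\<Prod>i<length es. (es ! \<sigma> i) \<bullet> (es ! i)) = (if \<sigma> = id then 1 else 0)"
    if \<sigma>: "\<sigma> permutes {..<length es}" for \<sigma>
  proof (cases "\<sigma> = id")
    case True
    then show ?thesis using assms by (auto simp: sign_id intro!: prod.neutral inner_same_Basis)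
  next
    case False
    then obtain i where i: "\<sigma> i \<noteq> i" by (auto simp: fun_eq_iff)
    then have "i < length es" "\<sigma> i < length es"
      using \<sigma> permutes_in_image[OF \<sigma>, of i] by (auto simp: permutes_def)
    then have "(es ! \<sigma> i) \<bullet> (es ! i) = 0"
      using assms i by (intro inner_not_same_Basis) (auto simp: nth_eq_iff_index_eq)
    then have "(\<Prod>i<length es. (es ! \<sigma> i) \<bullet> (es ! i)) = 0"
      using \<open>i < length es\<close> by (auto intro!: prod_zero)
    then show ?thesis using False by simp
  qed
  then have "det_form es es = (\<Sum>\<sigma> | \<sigma> permutes {..<length es}. if \<sigma> = id then 1 else 0)"
    unfolding det_form_def by simp
  also have "\<dots> = 1"
    by (subst sum.delta) (auto simp: finite_permutations permutes_id)
  finally show ?thesis .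
qed

text \<open>A basis vector of es that is missing from vs is orthogonal to all of vs and makes a
  factor of every product vanish.\<close>

lemma det_form_other:
  assumes "set es \<subseteq> Basis" "set vs \<subseteq> Basis" "\<not> set es \<subseteq> set vs"
  shows "det_form es vs = 0"
proof (cases "length vs = length es")
  case True
  obtain i where i: "i < length es" "es ! i \<notin> set vs"
    using assms(3) by (metis in_set_conv_nth subsetI)
  have "(\<Prod>i<length es. (vs ! \<sigma> i) \<bullet> (es ! i)) = 0" if \<sigma>: "\<sigma> permutes {..<length es}" for \<sigma>
  proof -
    have "\<sigma> i < length vs" using permutes_in_image[OF \<sigma>, of i] i True by auto
    then have "vs ! \<sigma> i \<in> set vs" by simp
    then have "(vs ! \<sigma> i) \<bullet> (es ! i) = 0"
      using assms i by (intro inner_not_same_Basis) (auto dest: nth_mem)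
    then show ?thesis using i by (auto intro!: prod_zero)
  qed
  then show ?thesis unfolding det_form_def by (simp del: prod_zero_iff)
qed (simp add: det_form_def)

text \<open>Polarisation: expanding the form with the sum of both vectors in both slots shows that
  the two mixed values are opposite. Tracking only the value 0 avoids signs of permutations.\<close>

lemma alternating_zero_swap:
  assumes \<alpha>: "alternating p \<alpha>" and len: "length vs = p" and ab: "a < p" "b < p" "a \<noteq> b" and 0: "\<alpha> vs = 0"
  shows "\<alpha> (permute_list (Transposition.transpose a b) vs) = 0"
proof -
  have lin: "linear (\<lambda>v. \<alpha> (ws[i := v]))" if "length ws = p" "i < p" for ws i
    using \<alpha> that unfolding alternating_def by auto
  have eq: "\<alpha> ws = 0" if "length ws = p" "ws ! a = ws ! b" for ws
    using \<alpha> that ab unfolding alternating_def by (metis nat_neq_iff)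
  define F where "F x y = \<alpha> (vs[a := x, b := y])" for x y
  have F0: "F x x = 0" for x
    unfolding F_def using ab len by (intro eq) auto
  have F1: "F (x + x') y = F x y + F x' y" for x x' y
    using linear_add[OF lin[of "vs[b := y]" a], of x x'] ab len
    unfolding F_def by (simp add: list_update_swap[of a b])
  have F2: "F x (y + y') = F x y + F x y'" for x y y'
    using linear_add[OF lin[of "vs[a := x]" b], of y y'] ab len
    unfolding F_def by simp
  have "F (vs ! a + vs ! b) (vs ! a + vs ! b) = F (vs ! a) (vs ! b) + F (vs ! b) (vs ! a)"
    by (subst F1, subst F2, subst F2) (simp add: F0)
  moreover have "F (vs ! a) (vs ! b) = 0"
    using 0 unfolding F_def by simp
  ultimately have "F (vs ! b) (vs ! a) = 0"
    using F0 by simp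
  moreover have "permute_list (Transposition.transpose a b) vs = vs[a := vs ! b, b := vs ! a]"
    using ab len by (intro nth_equalityI) 
      (auto simp: permute_list_def nth_list_update Transposition.transpose_def)
  ultimately show ?thesis unfolding F_def by simp
qed

lemma alternating_zero_permute:
  assumes \<alpha>: "alternating p \<alpha>" and len: "length vs = p" and \<sigma>: "\<sigma> permutes {..<p}" and 0: "\<alpha> vs = 0"
  shows "\<alpha> (permute_list \<sigma> vs) = 0"
  using finite_lessThan[of p] \<sigma>
proof (induction rule: permutes_rev_induct)
  case id
  then show ?case using 0 by simp
next
  case (swap a b \<sigma>)
  have "Transposition.transpose a b permutes {..<length vs}"
    using swap len by (intro permutes_swap_id) auto
  then show ?case
    using swap len by (simp add: permute_list_compose alternating_zero_swap[OF \<alpha>] del: o_apply comp_apply)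
qed

lemma alternating_eq_0I:
  fixes \<alpha> :: "'a::euclidean_space list \<Rightarrow> real"
  assumes \<alpha>: "alternating p \<alpha>"
    and 0: "\<And>vs. length vs = p \<Longrightarrow> set vs \<subseteq> Basis \<Longrightarrow> \<alpha> vs = 0"
  shows "\<alpha> vs = 0"
proof -
  \<comment> \<open>Here k counts the leading arguments that may be arbitrary. Each induction step
    expands the last of them in the orthonormal basis; for k = p nothing is required of the
    entries.\<close>
  have "\<alpha> vs = 0" if "length vs = p" "k \<le> p" "set (drop k vs) \<subseteq> Basis" for k vs
    using that
  proof (induction k arbitrary: vs)
    case 0
    then show ?case using assms(2) by simp
  next
    case (Suc k)
    have lin: "linear (\<lambda>v. \<alpha> (vs[k := v]))"
      using \<alpha> Suc.prems unfolding alternating_def by auto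
    have "\<alpha> (vs[k := e]) = 0" if "e \<in> Basis" for e
    proof (rule Suc.IH)
      have "drop k (vs[k := e]) = e # drop (Suc k) vs"
        using Suc.prems by (simp add: Cons_nth_drop_Suc[symmetric])
      then show "set (drop k (vs[k := e])) \<subseteq> Basis"
        using Suc.prems that by simp
    qed (use Suc.prems in auto)
    moreover have "\<alpha> vs = \<alpha> (vs[k := (\<Sum>e\<in>Basis. (vs ! k \<bullet> e) *\<^sub>R e)])"
      by (simp add: euclidean_representation)
    ultimately show ?case
      by (simp add: linear_sum[OF lin] linear_cmul[OF lin])
  qed
  from this[of vs p] show ?thesis
    using \<alpha> unfolding alternating_def by (cases "length vs = p") auto
qed

section \<open>The basis dx_I of the alternating p-forms\<close>

definition multi_indices :: "nat \<Rightarrow> 'a::euclidean_space set set" where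
  "multi_indices p = {I. I \<subseteq> Basis \<and> card I = p}"

text \<open>\<open>Basis\<close> carries no order, so each index set gets a chosen enumeration in
  place of the increasing one. The same enumeration enters dx_I and the coefficient at dx_I, so its
  sign cancels in the expansion.\<close>

definition list_of :: "'a set \<Rightarrow> 'a list" where
  "list_of I = (SOME xs. set xs = I \<and> distinct xs)"

lemma list_of: "finite I \<Longrightarrow> set (list_of I) = I" "finite I \<Longrightarrow> distinct (list_of I)"
  using someI_ex[OF finite_distinct_list[of I]] unfolding list_of_def by blast+

lemma multi_indices_finite: "I \<in> multi_indices p \<Longrightarrow> finite I"
  unfolding multi_indices_def using finite_subset[OF _ finite_Basis] by blast

lemma length_list_of:
  assumes "I \<in> multi_indices p"
  shows "length (list_of I) = p"
proof -
  have "card (set (list_of I)) = length (list_of I)"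
    using list_of(2)[OF multi_indices_finite[OF assms]] by (rule distinct_card)
  then show ?thesis
    using assms list_of(1)[OF multi_indices_finite[OF assms]] by (simp add: multi_indices_def)
qed

lemma finite_multi_indices: "finite (multi_indices p)"
  unfolding multi_indices_def by simp

lemma card_multi_indices: "card (multi_indices p :: 'a::euclidean_space set set) = DIM('a) choose p"
  unfolding multi_indices_def by (rule n_subsets[OF finite_Basis])

text \<open>The forms dx_I and the evaluations at \<open>list_of J\<close> are dual to each other:
  two different sets of the same size p do not contain one another, so some vector of I is missing
  from J.\<close>

lemma det_form_list_of:
  assumes "I \<in> multi_indices p" "J \<in> multi_indices p"
  shows "det_form (list_of I) (list_of J) = (if I = J then 1 else 0)"
proof (cases "I = J")
  case True
  then show ?thesis
    using assms list_of[OF multi_indices_finite[OF assms(1)]]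
    by (simp add: det_form_self multi_indices_def)
next
  case False
  then have "\<not> I \<subseteq> J"
    using assms card_subset_eq[OF multi_indices_finite[OF assms(2)], of I] by (auto simp: multi_indices_def)
  then show ?thesis
    using False assms list_of(1)[OF multi_indices_finite[OF assms(1)]] list_of(1)[OF multi_indices_finite[OF assms(2)]]
    by (simp add: det_form_other multi_indices_def)
qed

lemma alternating_minus_sum:
  assumes "alternating p \<alpha>" "\<And>i. i \<in> I \<Longrightarrow> alternating p (\<beta> i)"
  shows "alternating p (\<lambda>vs. \<alpha> vs - (\<Sum>i\<in>I. c i * \<beta> i vs))"
proof -
  have "linear (\<lambda>v. \<alpha> (vs[k := v]) - (\<Sum>i\<in>I. c i * \<beta> i (vs[k := v])))"
    if "length vs = p" "k < p" for vs k
  proof (intro linear_compose_sub linear_compose_sum ballI)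
    show "linear (\<lambda>v. \<alpha> (vs[k := v]))"
      using assms(1) that unfolding alternating_def by simp
    show "linear (\<lambda>v. c i * \<beta> i (vs[k := v]))" if "i \<in> I" for i
      using assms(2)[OF that] \<open>length vs = p\<close> \<open>k < p\<close> linear_compose_scale_right[of "\<lambda>v. \<beta> i (vs[k := v])" "c i"]
      unfolding alternating_def by simp
  qed
  then show ?thesis
    using assms unfolding alternating_def by (auto intro!: sum.neutral)
qed

text \<open>The difference of both sides is alternating, so it suffices to test it on lists of basis
  vectors. With a repeated entry it vanishes at once; a list without repetition is a permutation of
  some \<open>list_of J\<close>, where duality leaves a single summand.\<close>

lemma alternating_expansion:
  fixes \<alpha> :: "'a::euclidean_space list \<Rightarrow> real"
  assumes \<alpha>: "alternating p \<alpha>"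
  shows "\<alpha> vs = (\<Sum>I\<in>multi_indices p. \<alpha> (list_of I) * det_form (list_of I) vs)"
proof -
  define \<beta> where "\<beta> vs = \<alpha> vs - (\<Sum>I\<in>multi_indices p. \<alpha> (list_of I) * det_form (list_of I) vs)" for vs
  have \<beta>: "alternating p \<beta>"
    unfolding \<beta>_def[abs_def] 
    by (intro alternating_minus_sum \<alpha> alternating_det_form length_list_of)
  have "\<beta> vs = 0"
  proof (rule alternating_eq_0I[OF \<beta>])
    fix vs :: "'a list"
    assume vs: "length vs = p" "set vs \<subseteq> Basis"
    show "\<beta> vs = 0"
    proof (cases "distinct vs")
      case True
      define J where "J = set vs"
      have J: "J \<in> multi_indices p"
        using distinct_card[OF True] vs by (simp add: J_def multi_indices_def)
      have "\<beta> (list_of J) = 0"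
        unfolding \<beta>_def using J 
        by (simp add: det_form_list_of if_distrib finite_multi_indices sum.delta cong: if_cong)
      moreover have "mset vs = mset (list_of J)"
        using True list_of[OF multi_indices_finite[OF J]] unfolding J_def
        by (simp add: set_eq_iff_mset_eq_distinct[symmetric])
      then obtain \<sigma> where "\<sigma> permutes {..<length (list_of J)}" "permute_list \<sigma> (list_of J) = vs"
        by (rule mset_eq_permutation)
      ultimately show ?thesis
        using alternating_zero_permute[OF \<beta>, of "list_of J" \<sigma>] length_list_of[OF J] by simp
    next
      case False
      then obtain i j where "i < j" "j < length vs" "vs ! i = vs ! j"
        unfolding distinct_conv_nth by (metis linorder_neqE_nat)
      then show ?thesis using \<beta> vs unfolding alternating_def by blast
    qed
  qed
  then show ?thesis unfolding \<beta>_def by simp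
qed

section \<open>Dimensions of direct sums\<close>

context vector_space
begin

text \<open>Here \<open>T k\<close> embeds V as the k-th copy in W and \<open>P k\<close> projects
  back. The images under all \<open>T k\<close> of a basis of V form a basis of W. The first claim
  transfers finite spanning sets in both directions, as the case distinction in
  \<open>form_dim\<close> requires.\<close>

lemma
  assumes K: "finite K" "K \<noteq> {}"
    and T: "\<And>k. module_hom scale scale (T k)" and P: "\<And>k. module_hom scale scale (P k)"
    and TV: "\<And>k v. k \<in> K \<Longrightarrow> v \<in> V \<Longrightarrow> T k v \<in> W" and PW: "\<And>k w. k \<in> K \<Longrightarrow> w \<in> W \<Longrightarrow> P k w \<in> V"
    and PT: "\<And>j k v. j \<in> K \<Longrightarrow> k \<in> K \<Longrightarrow> v \<in> V \<Longrightarrow> P j (T k v) = (if j = k then v else 0)"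
    and TP: "\<And>w. w \<in> W \<Longrightarrow> (\<Sum>k\<in>K. T k (P k w)) = w"
  shows finitely_spanned_direct_sum_copies:
      "(\<exists>B. finite B \<and> W \<subseteq> span B) \<longleftrightarrow> (\<exists>B. finite B \<and> V \<subseteq> span B)"
    and dim_direct_sum_copies: "\<exists>B. finite B \<and> V \<subseteq> span B \<Longrightarrow> dim W = card K * dim V"
proof -
  have span: "W \<subseteq> span ((\<lambda>(k, b). T k b) ` (K \<times> B))" if B: "V \<subseteq> span B" for B
  proof
    fix w assume w: "w \<in> W"
    have "T k (P k w) \<in> span ((\<lambda>(k, b). T k b) ` (K \<times> B))" if k: "k \<in> K" for k
    proof -
      have "T k (P k w) \<in> span (T k ` B)"
        using module_hom.spans_image[OF T B] PW[OF k w] by blast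
      moreover have "T k ` B \<subseteq> (\<lambda>(k, b). T k b) ` (K \<times> B)"
        using k by auto
      ultimately show ?thesis using span_mono by blast
    qed
    then have "(\<Sum>k\<in>K. T k (P k w)) \<in> span ((\<lambda>(k, b). T k b) ` (K \<times> B))"
      by (rule span_sum)
    then show "w \<in> span ((\<lambda>(k, b). T k b) ` (K \<times> B))"
      using TP[OF w] by simp
  qed
  show "(\<exists>B. finite B \<and> W \<subseteq> span B) \<longleftrightarrow> (\<exists>B. finite B \<and> V \<subseteq> span B)"
  proof
    assume "\<exists>B. finite B \<and> W \<subseteq> span B"
    then obtain B where B: "finite B" "W \<subseteq> span B" by blast
    obtain k where k: "k \<in> K" using K by blast
    have "v \<in> span (P k ` B)" if v: "v \<in> V" for v
    proof -
      have "P k (T k v) \<in> span (P k ` B)"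
        using module_hom.spans_image[OF P B(2)] TV[OF k v] by blast
      then show ?thesis using PT[OF k k v] by simp
    qed
    then show "\<exists>B. finite B \<and> V \<subseteq> span B"
      using B(1) by (intro exI[of _ "P k ` B"]) auto
  next
    assume "\<exists>B. finite B \<and> V \<subseteq> span B"
    then show "\<exists>B. finite B \<and> W \<subseteq> span B"
      using span K(1) by (meson finite_SigmaI finite_imageI)
  qed
  assume "\<exists>B. finite B \<and> V \<subseteq> span B"
  then obtain A where A: "finite A" "V \<subseteq> span A" by blast
  obtain B where B: "B \<subseteq> V" "independent B" "V \<subseteq> span B" "card B = dim V"
    by (rule basis_exists)
  have finB: "finite B"
    using independent_span_bound[OF A(1) B(2)] A(2) B(1) by blast
  \<comment> \<open>\<open>P k\<close> recovers b from \<open>T k b\<close> but sends the other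
    copies to 0, and elements of a basis are nonzero, so the index is determined as well.\<close>
  have inj: "inj_on (\<lambda>(k, b). T k b) (K \<times> B)"
  proof (rule inj_onI, clarify)
    fix k b j c assume *: "k \<in> K" "b \<in> B" "j \<in> K" "c \<in> B" "T k b = T j c"
    then have "b \<in> V" "c \<in> V" using B(1) by auto
    then have "b = (if k = j then c else 0)"
      using PT[of k k b] PT[of k j c] * by (metis (full_types))
    moreover have "b \<noteq> 0"
      using * B(2) dependent_zero by blast
    ultimately show "k = j \<and> b = c" by (auto split: if_splits)
  qed
  have "independent ((\<lambda>(k, b). T k b) ` (K \<times> B))"
  proof (rule independent_if_scalars_zero)
    show "finite ((\<lambda>(k, b). T k b) ` (K \<times> B))"
      using K(1) finB by simp
    fix f x
    assume sum0: "(\<Sum>x\<in>(\<lambda>(k, b). T k b) ` (K \<times> B). scale (f x) x) = 0"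
      and "x \<in> (\<lambda>(k, b). T k b) ` (K \<times> B)"
    then obtain j b where x: "j \<in> K" "b \<in> B" "x = T j b" by auto
    \<comment> \<open>Applying \<open>P j\<close> to the relation keeps only the j-th copy and
      leaves a relation inside B.\<close>
    have "0 = P j (\<Sum>k\<in>K. \<Sum>c\<in>B. scale (f (T k c)) (T k c))"
      using sum0 module_hom.zero[OF P] unfolding sum.reindex[OF inj]
      by (simp add: sum.cartesian_product case_prod_unfold)
    also have "\<dots> = (\<Sum>k\<in>K. \<Sum>c\<in>B. scale (f (T k c)) (P j (T k c)))"
      by (simp add: module_hom.sum[OF P] module_hom.scale[OF P])
    also have "\<dots> = (\<Sum>k\<in>K. if j = k then (\<Sum>c\<in>B. scale (f (T k c)) c) else 0)"
      using PT[OF x(1)] B(1) by (intro sum.cong refl) (auto intro!: sum.cong sum.neutral)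
    also have "\<dots> = (\<Sum>c\<in>B. scale (f (T j c)) c)"
      using K(1) x(1) by simp
    finally show "f x = 0"
      using independentD[OF B(2) finB order_refl, of "\<lambda>c. f (T j c)" b] x by simp
  qed
  moreover have "(\<lambda>(k, b). T k b) ` (K \<times> B) \<subseteq> W"
    using TV B(1) by auto
  ultimately have "dim W = card ((\<lambda>(k, b). T k b) ` (K \<times> B))"
    using span[OF B(3)] by (metis basis_card_eq_dim)
  then show "dim W = card K * dim V"
    using B(4) by (simp add: card_image[OF inj] card_cartesian_product)
qed

end

section \<open>Forms with components in a given function space\<close>

lemma sum_fun_apply: "(\<Sum>i\<in>I. f i) x = (\<Sum>i\<in>I. f i x)"
  by (induction I rule: infinite_finite_induct) auto

text \<open>Components on all lists of constant vectors are considered, since \<open>nabla\<close>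
  and \<open>hodge_laplacian\<close> act on each of them separately. On lists of the wrong length
  they are 0, which is why S is required to contain the zero function.\<close>

definition component_forms :: "nat \<Rightarrow> ('a::real_vector \<Rightarrow> real) set \<Rightarrow> 'a form set" where
  "component_forms p S = {\<omega>. (\<forall>x. alternating p (\<omega> x)) \<and> (\<forall>vs. (\<lambda>x. \<omega> x vs) \<in> S)}"

lemma alternating_cmult:
  assumes "alternating p \<alpha>"
  shows "alternating p (\<lambda>vs. c * \<alpha> vs)"
proof -
  have "linear (\<lambda>v. c * \<alpha> (vs[i := v]))" if "length vs = p" "i < p" for vs i
    using assms that linear_compose_scale_right[of "\<lambda>v. \<alpha> (vs[i := v])" c]
    unfolding alternating_def by simp
  then show ?thesis using assms unfolding alternating_def by simp
qed

lemma alternating_0_iff: "alternating 0 \<alpha> \<longleftrightarrow> (\<forall>vs. vs \<noteq> [] \<longrightarrow> \<alpha> vs = 0)"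
  unfolding alternating_def by simp

text \<open>A function is passed as a 0-form and read off at the empty list. Source and target then
  lie in the same vector space, as the lemma on direct sums of copies demands.\<close>

definition form_of_function :: "'a::real_inner list \<Rightarrow> 'a form \<Rightarrow> 'a form" where
  "form_of_function es \<eta> x vs = \<eta> x [] * det_form es vs"

definition component_of_form :: "'a list \<Rightarrow> 'a form \<Rightarrow> 'a form" where
  "component_of_form es \<omega> x vs = (if vs = [] then \<omega> x es else 0)"

context
  fixes S :: "('a::euclidean_space \<Rightarrow> real) set"
  assumes zero: "(\<lambda>x. 0) \<in> S" and cmult: "\<And>c f. f \<in> S \<Longrightarrow> (\<lambda>x. c * f x) \<in> S"
begin

lemma form_of_function_mem:
  assumes "\<eta> \<in> component_forms 0 S" "length es = p"
  shows "form_of_function es \<eta> \<in> component_forms p S"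
proof -
  have "(\<lambda>x. \<eta> x []) \<in> S" using assms(1) unfolding component_forms_def by blast
  then have "(\<lambda>x. \<eta> x [] * det_form es vs) \<in> S" for vs
    using cmult[of "\<lambda>x. \<eta> x []" "det_form es vs"] by (simp add: mult.commute)
  then show ?thesis
    unfolding component_forms_def form_of_function_def
    using alternating_cmult[OF alternating_det_form[OF assms(2)]] by simp
qed

lemma component_of_form_mem:
  assumes "\<omega> \<in> component_forms p S"
  shows "component_of_form es \<omega> \<in> component_forms 0 S"
proof -
  have "(\<lambda>x. \<omega> x es) \<in> S" using assms unfolding component_forms_def by blast
  then have "(\<lambda>x. if vs = [] then \<omega> x es else 0) \<in> S" for vs :: "'a list"
    by (cases vs) (simp_all add: zero)
  then show ?thesis
    unfolding component_forms_def component_of_form_def alternating_0_iff by simp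
qed

lemma component_forms_nonzero_iff:
  assumes "p \<le> DIM('a)"
  shows "(\<exists>\<omega>\<in>component_forms p S. \<omega> \<noteq> 0) \<longleftrightarrow> (\<exists>f\<in>S. f \<noteq> (\<lambda>x. 0))"
proof
  assume "\<exists>\<omega>\<in>component_forms p S. \<omega> \<noteq> 0"
  then obtain \<omega> x vs where "\<omega> \<in> component_forms p S" "\<omega> x vs \<noteq> 0"
    by (auto simp: fun_eq_iff)
  then show "\<exists>f\<in>S. f \<noteq> (\<lambda>x. 0)"
    unfolding component_forms_def by (intro bexI[of _ "\<lambda>x. \<omega> x vs"]) (auto dest: fun_cong)
next
  assume "\<exists>f\<in>S. f \<noteq> (\<lambda>x. 0)"
  then obtain f x where f: "f \<in> S" "f x \<noteq> 0" by (auto simp: fun_eq_iff)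
  define \<eta> :: "'a form" where "\<eta> = (\<lambda>x vs. if vs = [] then f x else 0)"
  have "(\<lambda>x. \<eta> x vs) \<in> S" for vs
    using f zero by (cases vs) (simp_all add: \<eta>_def)
  then have \<eta>: "\<eta> \<in> component_forms 0 S"
    by (simp add: component_forms_def \<eta>_def alternating_0_iff)
  \<comment> \<open>For p at most the dimension there is some dx_I, and f dx_I takes the values of f
    on \<open>list_of I\<close>.\<close>
  have "card (multi_indices p :: 'a set set) \<noteq> 0"
    using assms by (simp add: card_multi_indices)
  then obtain I :: "'a set" where I: "I \<in> multi_indices p"
    by (metis card.empty ex_in_conv)
  have "form_of_function (list_of I) \<eta> x (list_of I) \<noteq> 0"
    using f(2) by (simp add: form_of_function_def det_form_list_of[OF I I] \<eta>_def)
  then show "\<exists>\<omega>\<in>component_forms p S. \<omega> \<noteq> 0"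
    using form_of_function_mem[OF \<eta> length_list_of[OF I]]
    by (intro bexI[of _ "form_of_function (list_of I) \<eta>"]) auto
qed

lemma form_dim_component_forms:
  assumes "p \<le> DIM('a)"
  shows "form_dim (component_forms p S) = of_nat (DIM('a) choose p) * form_dim (component_forms 0 S)"
proof -
  let ?T = "\<lambda>I. form_of_function (list_of I)" and ?P = "\<lambda>I. component_of_form (list_of I)"
  have card: "card (multi_indices p :: 'a set set) = DIM('a) choose p"
    by (rule card_multi_indices)
  have ne: "(multi_indices p :: 'a set set) \<noteq> {}"
    using assms card by (metis binomial_eq_0_iff card.empty not_le)
  have T: "module_hom form_scale form_scale (?T I)" for I :: "'a set"
    by unfold_locales (auto simp: form_of_function_def form_scale_def fun_eq_iff algebra_simps)
  have P: "module_hom form_scale form_scale (?P I)" for I :: "'a set"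
    by unfold_locales (auto simp: component_of_form_def form_scale_def fun_eq_iff)
  have PT: "?P J (?T I \<eta>) = (if J = I then \<eta> else 0)"
    if "J \<in> multi_indices p" "I \<in> multi_indices p" "\<eta> \<in> component_forms 0 S" for I J \<eta>
  proof (intro ext)
    fix x vs
    have "vs \<noteq> [] \<Longrightarrow> \<eta> x vs = 0"
      using that(3) by (simp add: component_forms_def alternating_0_iff)
    then show "?P J (?T I \<eta>) x vs = (if J = I then \<eta> else 0) x vs"
      using det_form_list_of[OF that(2,1)] by (cases "J = I") (auto simp: component_of_form_def form_of_function_def)
  qed
  have TP: "(\<Sum>I\<in>multi_indices p. ?T I (?P I \<omega>)) = \<omega>" if "\<omega> \<in> component_forms p S" for \<omega>
  proof (intro ext)
    fix x vs
    have "(\<Sum>I\<in>multi_indices p. ?T I (?P I \<omega>)) x vs =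
        (\<Sum>I\<in>multi_indices p. \<omega> x (list_of I) * det_form (list_of I) vs)"
      by (simp add: sum_fun_apply form_of_function_def component_of_form_def)
    then show "(\<Sum>I\<in>multi_indices p. ?T I (?P I \<omega>)) x vs = \<omega> x vs"
      using alternating_expansion[of p "\<omega> x" vs] that by (simp add: component_forms_def)
  qed
  note copies = finite_multi_indices ne T P form_of_function_mem[OF _ length_list_of]
    component_of_form_mem PT TP
  have fin: "(\<exists>B. finite B \<and> component_forms p S \<subseteq> form.span B) \<longleftrightarrow>
      (\<exists>B. finite B \<and> component_forms 0 S \<subseteq> form.span B)"
    by (rule form.finitely_spanned_direct_sum_copies[where T = ?T and P = ?P]; (rule copies; assumption))
  have dim: "form.dim (component_forms p S) = (DIM('a) choose p) * form.dim (component_forms 0 S)"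
    if "\<exists>B. finite B \<and> component_forms 0 S \<subseteq> form.span B"
    unfolding card[symmetric]
    by (rule form.dim_direct_sum_copies[where T = ?T and P = ?P]; (rule copies that; assumption?))
  \<comment> \<open>In the infinite-dimensional case the product with \<infinity> is again
    \<infinity> only because the binomial coefficient is not 0.\<close>
  have "DIM('a) choose p \<noteq> 0" using assms by simp
  then show ?thesis
    unfolding form_dim_def fin using dim by (auto simp: of_nat_eq_enat imult_infinity_right)
qed

end

section \<open>Clamped functions\<close>

text \<open>Q stands for the right-hand side of the equation, \<Lambda> times the Laplacian of f or
  \<Gamma> f, so that both problems are treated together.\<close>

definition clamped_functions ::
    "'a::euclidean_space set \<Rightarrow> (('a \<Rightarrow> real) \<Rightarrow> 'a \<Rightarrow> real) \<Rightarrow> ('a \<Rightarrow> real) set" where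
  "clamped_functions M Q = {f. smooth_upto M f \<and> (\<forall>x. x \<notin> M \<longrightarrow> f x = 0) \<and>
     (\<forall>x\<in>frontier M. f x = 0 \<and> partial M (inward_unit_normal M x) f x = 0) \<and>
     (\<forall>x\<in>M. laplacian M (laplacian M f) x = Q f x)}"

context
  fixes M :: "'a::euclidean_space set"
  assumes M: "smooth_bounded_domain M"
begin

lemma clamped_functions_zero:
  assumes "\<And>x. Q (\<lambda>x. 0) x = 0"
  shows "(\<lambda>x. 0) \<in> clamped_functions M Q"
proof -
  have "laplacian M (\<lambda>x. 0) = (\<lambda>x. 0)"
    using laplacian_cmult[OF M smooth_upto_const, of 0 0] by simp
  then show ?thesis
    by (simp add: clamped_functions_def smooth_upto_const partial_zero[OF M] assms)
qed

lemma clamped_functions_cmult: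
  assumes Q: "\<And>c f x. smooth_upto M f \<Longrightarrow> Q (\<lambda>x. c * f x) x = c * Q f x"
    and f: "f \<in> clamped_functions M Q"
  shows "(\<lambda>x. c * f x) \<in> clamped_functions M Q"
  using f by (simp add: clamped_functions_def Q smooth_upto_cmult partial_cmult[OF M]
      laplacian_cmult[OF M] smooth_upto_laplacian[OF M])

text \<open>The normal depends on M alone, so the boundary conditions, like the equation, can be
  evaluated on each list separately. If some component is not smooth, both sides exclude the form;
  otherwise the Laplacian is replaced twice by its action on components.\<close>

lemma clamped_problem_eq:
  "{\<omega>. smooth_form M p \<omega> \<and> clamped_boundary M \<omega> \<and>
     (\<forall>x\<in>M. hodge_laplacian M (hodge_laplacian M \<omega>) x = (\<lambda>vs. Q (\<lambda>y. \<omega> y vs) x))} =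
   component_forms p (clamped_functions M Q)" (is "?L = ?R")
proof -
  have "\<omega> \<in> ?L \<longleftrightarrow> \<omega> \<in> ?R" for \<omega>
  proof (cases "\<forall>vs. smooth_upto M (\<lambda>x. \<omega> x vs)")
    case True
    then have "hodge_laplacian M (hodge_laplacian M \<omega>) =
        (\<lambda>x vs. laplacian M (laplacian M (\<lambda>y. \<omega> y vs)) x)"
      by (simp add: hodge_laplacian_eq[OF M] smooth_upto_laplacian[OF M])
    with True show ?thesis
      unfolding smooth_form_def clamped_boundary_def component_forms_def clamped_functions_def
      by (auto simp: fun_eq_iff nabla_eq_partial)
  next
    case False
    then show ?thesis
      by (auto simp: smooth_form_def component_forms_def clamped_functions_def)
  qed
  then show ?thesis by blast
qed

lemma buckling_solutions_eq:
  "buckling_solutions M p \<Lambda> = component_forms p (clamped_functions M (\<lambda>f x. \<Lambda> * laplacian M f x))"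
proof -
  have "smooth_form M p \<omega> \<Longrightarrow> hodge_laplacian M \<omega> = (\<lambda>x vs. laplacian M (\<lambda>y. \<omega> y vs) x)" for \<omega>
    by (rule hodge_laplacian_eq[OF M]) (simp add: smooth_form_def)
  then show ?thesis
    unfolding clamped_problem_eq[symmetric] buckling_solutions_def form_scale_def
    \<comment> \<open>\<open>conj_cong\<close> makes smoothness of the form available when the
      Laplacian on the right-hand side is rewritten.\<close>
    by (intro Collect_cong conj_cong refl) simp
qed

lemma plate_solutions_eq:
  "plate_solutions M p \<Gamma> = component_forms p (clamped_functions M (\<lambda>f x. \<Gamma> * f x))"
  unfolding clamped_problem_eq[symmetric] plate_solutions_def form_scale_def ..

section \<open>Comparison of degree p with degree 0\<close>

context
  fixes p :: nat
  assumes p: "p \<le> DIM('a)"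
begin

text \<open>In degree p and in degree 0 alike, \<Lambda> is an eigenvalue exactly if the same set of
  clamped functions contains a nonzero one.\<close>

lemma buckling_spectrum_eq: "buckling_spectrum M p = buckling_spectrum M 0"
  and buckling_multiplicity_eq:
    "buckling_multiplicity M p \<Lambda> = of_nat (DIM('a) choose p) * buckling_multiplicity M 0 \<Lambda>"
proof -
  have *: "(\<lambda>x. 0) \<in> clamped_functions M (\<lambda>f x. \<Lambda> * laplacian M f x)"
     "f \<in> clamped_functions M (\<lambda>f x. \<Lambda> * laplacian M f x) \<Longrightarrow>
      (\<lambda>x. c * f x) \<in> clamped_functions M (\<lambda>f x. \<Lambda> * laplacian M f x)" for \<Lambda> c f
    using laplacian_cmult[OF M smooth_upto_const, of 0 0]
    by (auto intro!: clamped_functions_zero clamped_functions_cmult simp: laplacian_cmult[OF M])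
  show "buckling_spectrum M p = buckling_spectrum M 0"
    unfolding buckling_spectrum_def buckling_solutions_eq
    by (simp add: component_forms_nonzero_iff[OF * p] component_forms_nonzero_iff[OF * le0])
  show "buckling_multiplicity M p \<Lambda> = of_nat (DIM('a) choose p) * buckling_multiplicity M 0 \<Lambda>"
    unfolding buckling_multiplicity_def buckling_solutions_eq
    by (rule form_dim_component_forms[OF * p])
qed

lemma plate_spectrum_eq: "plate_spectrum M p = plate_spectrum M 0"
  and plate_multiplicity_eq:
    "plate_multiplicity M p \<Gamma> = of_nat (DIM('a) choose p) * plate_multiplicity M 0 \<Gamma>"
proof -
  have *: "(\<lambda>x. 0) \<in> clamped_functions M (\<lambda>f x. \<Gamma> * f x)"
     "f \<in> clamped_functions M (\<lambda>f x. \<Gamma> * f x) \<Longrightarrow>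
      (\<lambda>x. c * f x) \<in> clamped_functions M (\<lambda>f x. \<Gamma> * f x)" for \<Gamma> c f
    by (auto intro!: clamped_functions_zero clamped_functions_cmult)
  show "plate_spectrum M p = plate_spectrum M 0"
    unfolding plate_spectrum_def plate_solutions_eq
    by (simp add: component_forms_nonzero_iff[OF * p] component_forms_nonzero_iff[OF * le0])
  show "plate_multiplicity M p \<Gamma> = of_nat (DIM('a) choose p) * plate_multiplicity M 0 \<Gamma>"
    unfolding plate_multiplicity_def plate_solutions_eq
    by (rule form_dim_component_forms[OF * p])
qed

end

end

theorem proposition3p1:
  fixes M :: "(real ^ 'n) set"
  assumes "smooth_bounded_domain M"
  shows "\<forall>p\<in>{1..CARD('n)}.
      buckling_spectrum M p = buckling_spectrum M 0 \<and>
      plate_spectrum M p = plate_spectrum M 0 \<and>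
      (\<forall>i\<ge>1.
        buckling_eigenvalue M i p = buckling_eigenvalue M i 0 \<and>
        plate_eigenvalue M i p = plate_eigenvalue M i 0 \<and>
        buckling_multiplicity M p (buckling_eigenvalue M i p) =
          of_nat (CARD('n) choose p) * buckling_multiplicity M 0 (buckling_eigenvalue M i 0) \<and>
        plate_multiplicity M p (plate_eigenvalue M i p) =
          of_nat (CARD('n) choose p) * plate_multiplicity M 0 (plate_eigenvalue M i 0))"
proof
  fix p assume "p \<in> {1..CARD('n)}"
  then have p: "p \<le> DIM(real ^ 'n)" by simp
  note spec = buckling_spectrum_eq[OF assms p] plate_spectrum_eq[OF assms p]
  note mult = buckling_multiplicity_eq[OF assms p] plate_multiplicity_eq[OF assms p]
  show "buckling_spectrum M p = buckling_spectrum M 0 \<and>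
      plate_spectrum M p = plate_spectrum M 0 \<and>
      (\<forall>i\<ge>1.
        buckling_eigenvalue M i p = buckling_eigenvalue M i 0 \<and>
        plate_eigenvalue M i p = plate_eigenvalue M i 0 \<and>
        buckling_multiplicity M p (buckling_eigenvalue M i p) =
          of_nat (CARD('n) choose p) * buckling_multiplicity M 0 (buckling_eigenvalue M i 0) \<and>
        plate_multiplicity M p (plate_eigenvalue M i p) =
          of_nat (CARD('n) choose p) * plate_multiplicity M 0 (plate_eigenvalue M i 0))"
    \<comment> \<open>Equal spectra have equal i-th smallest elements, so the multiplicities are
      compared at one and the same real number.\<close>
    by (simp add: buckling_eigenvalue_def plate_eigenvalue_def spec mult)
qed

end
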